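(* Let $T$ be a tree of order $n\ge 2$, rooted at a vertex, with vertex set $\{1,2,\ldots,n\}$ labelled so that the root is $1$ and $d(1,i)\le d(1,j)$ whenever $i<j$, and let $\mathrm{parent}[1\ldots n]$ be its parent array. Let $S=\{i\in\{1,\ldots,n\} : \mathrm{InPD}[i]=\text{true}\}$ be the set produced by Algorithm TREE PAIRED DOMINATION on input $T$. Then $S$ is a $\gamma_{\rm pr}$-set of $T$, i.e. $S$ is a paired dominating set of $T$ with $|S|=\gamma_{\rm pr}(T)$.
   Context: A paired dominating set (PD-set) of a graph $G$ without isolated vertices is a set $S\subseteq V(G)$ such that every vertex of $V(G)\setminus S$ is adjacent to some vertex of $S$ and the induced subgraph $G[S]$ contains a perfect matching (not necessarily induced). The paired domination number $\gamma_{\rm pr}(G)$ is the minimum cardinality of a PD-set of $G$; a $\gamma_{\rm pr}$-set is a PD-set of cardinality $\gamma_{\rm pr}(G)$. $d(u,v)$ denotes graph distance. For $i\neq 1$, $\mathrm{parent}[i]$ is the neighbour of $i$ on the path from $i$ to the root $1$; by convention there is a dummy vertex $0$ with $\mathrm{parent}[1]=\mathrm{parent}[0]=0$. Algorithm TREE PAIRED DOMINATION (input: a rooted tree $T$ of order $n\ge 2$ with vertex set $\{1,2,\ldots,n\}$, labelled so that the root is $1$ and $d(1,i)\le d(1,j)$ whenever $i<j$, given by its parent array $\mathrm{parent}[1\ldots n]$; it maintains boolean arrays $\mathrm{InPD}[0..n]$ and $\mathrm{DomByChild}[0..n]$): 1. Initialise $\mathrm{InPD}[i]=\mathrm{DomByChild}[i]=\text{false}$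 for all $i=0,\ldots,n$. 2. For $i=n,n-1,\ldots,2$ in this order, write $p=\mathrm{parent}[i]$, $g=\mathrm{parent}[p]$, and do (a) and then (b): (a) If $\mathrm{DomByChild}[i]=\text{false}$ and $\mathrm{InPD}[p]=\text{false}$ and $p\ne 1$ and $\mathrm{InPD}[g]=\text{false}$, then set $\mathrm{InPD}[p]$, $\mathrm{InPD}[g]$, $\mathrm{DomByChild}[g]$ and $\mathrm{DomByChild}[\mathrm{parent}[g]]$ to true. (b) If (with the current values) $\mathrm{DomByChild}[i]=\text{false}$ and $\mathrm{InPD}[p]=\text{false}$ and ($p=1$ or $\mathrm{InPD}[g]=\text{true}$), then set $\mathrm{InPD}[p]=\text{true}$, and, letting $i_1$ be the child of $p$ of largest label with $\mathrm{InPD}[i_1]=\text{false}$, set $\mathrm{InPD}[i_1]=\text{true}$ and $\mathrm{DomByChild}[p]=\text{true}$. 3. After the loop: if $\mathrm{DomByChild}[1]=\text{false}$, set $\mathrm{InPD}[1]$, $\mathrm{InPD}[2]$ and $\mathrm{DomByChild}[1]$ to true. The output is the array $\mathrm{InPD}$. *)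

theory Defs
  imports "Graph_Theory.Graph_Theory"
begin

text \<open>
  A finite simple graph is a \<^locale>\<open>pair_graph\<close>: a finite, loop-free, symmetric set of arcs, each
  undirected edge being represented by its two orientations.  The constants
  \<^const>\<open>forest\<close> and \<^const>\<open>Digraph_Component.tree\<close> are not usable here: they exclude every
  directed cycle, so no symmetric digraph with an edge satisfies them.  In a loop-free symmetric
  digraph the cycles of length at least 3 are the cycles of the undirected graph; those of
  length 2 just traverse an edge back and forth.
\<close>

definition undirected_tree :: "'a pair_pre_digraph \<Rightarrow> bool" where
  "undirected_tree T \<longleftrightarrow>
     pair_graph T \<and> Digraph_Component.connected (with_proj T) \<and>
     \<not> (\<exists>p. pre_digraph.cycle (with_proj T) p \<and> length p \<ge> 3)"

definition graph_dist :: "('a, 'b) pre_digraph \<Rightarrow> 'a \<Rightarrow> 'a \<Rightarrow> ereal" where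
  "graph_dist G u v = wf_digraph.\<mu> G (\<lambda>_. 1) u v"

text \<open>
  The entry of a vertex other than the root 1 is the second vertex of its path to the root.  The
  entries 0 and 1 both are the dummy vertex 0, which is not a vertex of the tree; entries beyond
  \<open>n\<close> are irrelevant.
\<close>

definition parent_array :: "nat pair_pre_digraph \<Rightarrow> nat \<Rightarrow> (nat \<Rightarrow> nat) \<Rightarrow> bool" where
  "parent_array T n parent \<longleftrightarrow>
     parent 0 = 0 \<and> parent 1 = 0 \<and>
     (\<forall>i\<in>{1..n} - {1}. \<exists>p. pre_digraph.apath (with_proj T) i p 1 \<and> p \<noteq> [] \<and>
        parent i = head (with_proj T) (hd p))"


definition undirected_edges :: "('a, 'b) pre_digraph \<Rightarrow> 'a set set" where
  "undirected_edges G = {{tail G e, head G e} | e. e \<in> arcs G}"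

definition perfect_matching :: "('a, 'b) pre_digraph \<Rightarrow> 'a set set \<Rightarrow> bool" where
  "perfect_matching G M \<longleftrightarrow>
     M \<subseteq> undirected_edges G \<and> (\<forall>v\<in>verts G. \<exists>!e. e \<in> M \<and> v \<in> e)"

definition paired_dominating_set :: "('a, 'b) pre_digraph \<Rightarrow> 'a set \<Rightarrow> bool" where
  "paired_dominating_set G S \<longleftrightarrow>
     S \<subseteq> verts G \<and>
     (\<forall>v\<in>verts G - S. \<exists>u\<in>S. v \<rightarrow>\<^bsub>G\<^esub> u) \<and>
     (\<exists>M. perfect_matching (G \<restriction> S) M)"

text \<open>Meaningful for finite graphs without isolated vertices, where paired dominating sets exist.\<close>

definition paired_domination_number :: "('a, 'b) pre_digraph \<Rightarrow> nat" where
  "paired_domination_number G = Min (card ` {S. paired_dominating_set G S})"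

definition gamma_pr_set :: "('a, 'b) pre_digraph \<Rightarrow> 'a set \<Rightarrow> bool" where
  "gamma_pr_set G S \<longleftrightarrow>
     paired_dominating_set G S \<and> card S = paired_domination_number G"


record pd_state =
  InPD :: "nat \<Rightarrow> bool"
  DomByChild :: "nat \<Rightarrow> bool"

definition init_state :: pd_state where
  "init_state = \<lparr>InPD = (\<lambda>_. False), DomByChild = (\<lambda>_. False)\<rparr>"

definition step_a :: "(nat \<Rightarrow> nat) \<Rightarrow> nat \<Rightarrow> pd_state \<Rightarrow> pd_state" where
  "step_a parent i s =
     (let p = parent i; g = parent p in
      if \<not> DomByChild s i \<and> \<not> InPD s p \<and> p \<noteq> 1 \<and> \<not> InPD s g
      then s\<lparr>InPD := (InPD s)(p := True, g := True),
             DomByChild := (DomByChild s)(g := True, parent g := True)\<rparr>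
      else s)"

text \<open>
  In every run on a parent array, the set of candidates for \<open>i\<^sub>1\<close> contains \<open>i\<close> whenever the
  condition holds, so the maximum is never taken over the empty set.
\<close>

definition step_b :: "nat \<Rightarrow> (nat \<Rightarrow> nat) \<Rightarrow> nat \<Rightarrow> pd_state \<Rightarrow> pd_state" where
  "step_b n parent i s =
     (let p = parent i; g = parent p in
      if \<not> DomByChild s i \<and> \<not> InPD s p \<and> (p = 1 \<or> InPD s g)
      then let s' = s\<lparr>InPD := (InPD s)(p := True)\<rparr>;
               i\<^sub>1 = Max {j \<in> {1..n}. parent j = p \<and> \<not> InPD s' j}
           in s'\<lparr>InPD := (InPD s')(i\<^sub>1 := True),
                 DomByChild := (DomByChild s')(p := True)\<rparr>
      else s)"

definition main_loop :: "nat \<Rightarrow> (nat \<Rightarrow> nat) \<Rightarrow> pd_state" where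
  "main_loop n parent =
     fold (\<lambda>i s. step_b n parent i (step_a parent i s)) (rev [2..<Suc n]) init_state"

definition final_step :: "pd_state \<Rightarrow> pd_state" where
  "final_step s =
     (if \<not> DomByChild s 1
      then s\<lparr>InPD := (InPD s)(1 := True, 2 := True),
             DomByChild := (DomByChild s)(1 := True)\<rparr>
      else s)"

definition tree_paired_domination :: "nat \<Rightarrow> (nat \<Rightarrow> nat) \<Rightarrow> nat \<Rightarrow> bool" where
  "tree_paired_domination n parent = InPD (final_step (main_loop n parent))"

end

theory Submission
  imports Defs "HOL-Library.Disjoint_Sets"
begin

text \<open>
  Call a vertex a witness if its processing (or the final step, for the root) adds vertices to the
  set.  Each witness adds two adjacent new vertices, so the output has a perfect matching with as
  many edges as there are witnesses.  At that moment all vertices within distance 3 of the witness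
  that are processed later become dominated in the sense of the arrays, so witnesses are at
  pairwise distance at least 4.  An edge of the matching of any paired dominating set then
  dominates at most one witness, so no paired dominating set is smaller than the output.
\<close>

section \<open>Walks and parents in trees\<close>

lemma (in wf_digraph) awalk_cost_one: "awalk_cost (\<lambda>_. 1) p = length p"
  by (induction p) auto

text \<open>The infimum behind the distance ranges over walk lengths, which are natural numbers, so
  it is attained. This turns \<open>ereal\<close> distances into levels in
  \<open>nat\<close>.\<close>

lemma (in wf_digraph) graph_dist_eq_shortest:
  assumes "awalk u p v"
  shows "graph_dist G u v = ereal (real (LEAST k. \<exists>p. awalk u p v \<and> length p = k))"
    (is "_ = ereal (real (Least ?P))")
proof -
  have "\<exists>k. ?P k" using assms by blast
  from LeastI_ex[OF this] obtain q where q: "awalk u q v" "length q = Least ?P" by blast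
  have "Least ?P \<le> length r" if "awalk u r v" for r
    by (rule Least_le) (use that in blast)
  with q show ?thesis
    unfolding graph_dist_def \<mu>_def awalk_cost_one
    by (intro antisym INF_lower2[of q] INF_greatest) auto
qed

text \<open>A path from \<open>u\<close> to \<open>v\<close> that avoids the edge has at least two
  arcs; closing it up with \<open>(v, u)\<close> gives a cycle of length at least 3.\<close>

lemma edge_is_bridge:
  assumes tree: "undirected_tree T" and uv: "(u, v) \<in> parcs T"
  shows "\<not> u \<rightarrow>\<^sup>*\<^bsub>with_proj (T\<lparr>parcs := parcs T - {(u, v), (v, u)}\<rparr>)\<^esub> v"
proof
  define T' where "T' = T\<lparr>parcs := parcs T - {(u, v), (v, u)}\<rparr>"
  assume "u \<rightarrow>\<^sup>*\<^bsub>with_proj (T\<lparr>parcs := parcs T - {(u, v), (v, u)}\<rparr>)\<^esub> v"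
  then have reach: "u \<rightarrow>\<^sup>*\<^bsub>with_proj T'\<^esub> v" unfolding T'_def .
  interpret pair_graph T using tree unfolding undirected_tree_def by simp
  have "(v, u) \<in> parcs T" using uv by (metis arcs_symmetric)
  interpret T': pair_wf_digraph T'
    by unfold_locales (auto simp: T'_def dest: in_arcsD1 in_arcsD2)
  obtain p where p': "T'.apath u p v"
    using reach T'.reachable_apath by blast
  have "subgraph (with_proj T') (with_proj T)"
    by (intro subgraphI) (auto simp: T'_def compatible_def T'.wf_digraph_axioms[unfolded T'_def] wf_digraph_axioms)
  then have p: "apath u p v" by (rule subgraph_apath_imp_apath[OF p'])
  have "u \<noteq> v" using pair_no_loops[OF uv] by simp
  have "p \<noteq> []" using p' \<open>u \<noteq> v\<close> by (auto simp: T'.apath_Nil_iff)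
  moreover have "(u, v) \<notin> parcs T'" unfolding T'_def by simp
  then have "p \<noteq> [a]" for a
    using p' by (cases a) (auto simp: T'.apath_Cons_iff T'.apath_Nil_iff)
  ultimately have "length p \<ge> 2" by (cases p rule: remdups_adj.cases) auto
  moreover have "cycle (p @ [(v, u)])"
    unfolding cycle_def
  proof (intro exI conjI)
    show w: "awalk u (p @ [(v, u)]) u"
      using p \<open>(v, u) \<in> parcs T\<close> in_arcsD1[OF uv]
      by (auto simp: apath_def awalk_simps)
    have "awalk_verts u (p @ [(v, u)]) = awalk_verts u p @ [u]"
      using p w by (subst awalk_verts_append[OF w]) (auto simp: apath_def)
    moreover obtain vs where "awalk_verts u p = u # vs"
      using p by (cases p) (auto simp: apath_def awalk_Cons_iff)
    ultimately show "distinct (tl (awalk_verts u (p @ [(v, u)])))"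
      using p by (auto simp: apath_def)
  qed simp
  ultimately show False
    using tree unfolding undirected_tree_def by force
qed

text \<open>The last arc of a shortest walk from the root enters each non-root vertex from a vertex
  one level up. These edges alone connect the tree, and every edge is a bridge, so there are no
  others; hence the path to the root starts with such an edge.\<close>

lemma parent_structure:
  assumes tree: "undirected_tree T" and verts: "pverts T = {1..n}"
    and par: "parent_array T n parent"
    and depth: "\<And>i. depth i = (LEAST k. \<exists>p. pre_digraph.awalk (with_proj T) 1 p i \<and> length p = k)"
    and n: "1 \<le> n"
  shows "i \<in> {2..n} \<Longrightarrow> parent i \<in> {1..n} \<and> depth i = Suc (depth (parent i))"
    and "(u, v) \<in> parcs T \<longleftrightarrow> u \<in> {2..n} \<and> v = parent u \<or> v \<in> {2..n} \<and> u = parent v"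
    and "i \<in> {1..n} \<Longrightarrow> graph_dist (with_proj T) 1 i = ereal (depth i)"
proof -
  interpret pair_graph T using tree unfolding undirected_tree_def by simp
  have walk: "\<exists>p. awalk u p v" if "u \<in> {1..n}" "v \<in> {1..n}" for u v
  proof -
    have "strongly_connected (with_proj T)"
      using tree sym_arcs symmetric_connected_imp_strongly_connected
      unfolding undirected_tree_def by blast
    with that verts have "u \<rightarrow>\<^sup>*\<^bsub>with_proj T\<^esub> v" by auto
    then show ?thesis by (simp add: reachable_awalk)
  qed
  show "graph_dist (with_proj T) 1 i = ereal (depth i)" if "i \<in> {1..n}" for i
    using walk[of 1 i] that n graph_dist_eq_shortest depth by fastforce
  have depth_le: "depth i \<le> length p" if "awalk 1 p i" for i p
    unfolding depth by (rule Least_le) (use that in blast)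
  have shortest: "\<exists>p. awalk 1 p i \<and> length p = depth i" if "i \<in> {1..n}" for i
    unfolding depth by (rule LeastI_ex) (use walk[of 1 i] that n in auto)
  have "\<exists>q. (q, i) \<in> parcs T \<and> depth i = Suc (depth q)" if i: "i \<in> {2..n}" for i
  proof -
    obtain p where p: "awalk 1 p i" "length p = depth i" using shortest[of i] i by auto
    then have "p \<noteq> []" using i by (auto simp: awalk_Nil_iff)
    then obtain p' q j where pq: "p = p' @ [(q, j)]" by (metis rev_exhaust surj_pair)
    with p have q: "awalk 1 p' q" "(q, i) \<in> parcs T" by (auto simp: awalk_simps)
    then have "q \<in> {1..n}" using verts in_arcsD1 by auto
    then obtain r where r: "awalk 1 r q" "length r = depth q" using shortest by auto
    then have "awalk 1 (r @ [(q, i)]) i"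
      using q in_arcsD2[OF q(2)] by (auto simp: awalk_simps)
    from depth_le[OF this] have "depth i \<le> Suc (depth q)" using r(2) by simp
    moreover have "Suc (depth q) \<le> depth i" using depth_le[OF q(1)] p(2) pq by simp
    ultimately show ?thesis using q by auto
  qed
  then obtain q where q: "\<And>i. i \<in> {2..n} \<Longrightarrow> (q i, i) \<in> parcs T"
      "\<And>i. i \<in> {2..n} \<Longrightarrow> depth i = Suc (depth (q i))"
    by metis
  have q_sym: "(i, q i) \<in> parcs T" if "i \<in> {2..n}" for i
    using q(1)[OF that] arcs_symmetric by blast
  \<comment> \<open>Deleting an edge not of this form leaves every arc \<open>(w, q w)\<close> in
    place, so both its ends still reach 1 and thus each other, against
    \<open>edge_is_bridge\<close>.\<close>
  have arcs: "u \<in> {2..n} \<and> v = q u \<or> v \<in> {2..n} \<and> u = q v" if uv: "(u, v) \<in> parcs T" for u v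
  proof (rule ccontr)
    assume not: "\<not> ?thesis"
    define T' where "T' = T\<lparr>parcs := parcs T - {(u, v), (v, u)}\<rparr>"
    interpret T': pair_sym_digraph T'
      using arcs_symmetric by unfold_locales (auto simp: T'_def symmetric_def sym_def dest: in_arcsD1 in_arcsD2)
    have refl: "1 \<rightarrow>\<^sup>*\<^bsub>with_proj T'\<^esub> 1"
      by (rule T'.reachable_refl) (use n verts in \<open>simp add: T'_def\<close>)
    have root: "w \<in> {1..n} \<Longrightarrow> w \<rightarrow>\<^sup>*\<^bsub>with_proj T'\<^esub> 1" for w
    proof (induction "depth w" arbitrary: w)
      case 0
      then have "w = 1" using q(2)[of w] by fastforce
      then show ?case using refl by simp
    next
      case (Suc d)
      show ?case
      proof (cases "w = 1")
        case True
        then show ?thesis using refl by simp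
      next
        case False
        then have w: "w \<in> {2..n}" using Suc by auto
        then have "(w, q w) \<in> parcs T'" using q_sym[OF w] not unfolding T'_def by auto
        moreover have "q w \<rightarrow>\<^sup>*\<^bsub>with_proj T'\<^esub> 1"
          using Suc q[OF w] in_arcsD1 verts by (intro Suc.hyps(1)) auto
        ultimately show ?thesis by (rule T'.adj_reachable_trans)
      qed
    qed
    have "u \<rightarrow>\<^sup>*\<^bsub>with_proj T'\<^esub> v"
      using root[of u] root[of v] in_arcsD1[OF uv] in_arcsD2[OF uv] verts
        T'.symmetric_reachable' T'.reachable_trans by blast
    with edge_is_bridge[OF tree uv] show False unfolding T'_def by simp
  qed
  text \<open>A simple path whose first step leads away from the root can never turn back.\<close>
  have away: False
    if "apath h p 1" "i \<notin> set (awalk_verts h p)" "q h = i" "h \<noteq> 1" for h i p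
    using that
  proof (induction p arbitrary: h i)
    case Nil
    then show ?case by (simp add: apath_Nil_iff)
  next
    case (Cons a p)
    then obtain h' where h': "a = (h, h')" "(h, h') \<in> parcs T" "apath h' p 1" "h \<notin> set (awalk_verts h' p)"
      by (cases a) (auto simp: apath_Cons_iff)
    have "h' \<in> set (awalk_verts h (a # p))"
      using h' by (auto simp: apath_def hd_in_awalk_verts)
    with Cons have "h' \<noteq> q h" by auto
    with arcs[OF h'(2)] have "h = q h'" "h' \<noteq> 1" by auto
    with Cons.IH[OF h'(3,4)] show ?case by simp
  qed
  have parent: "parent i = q i" if i: "i \<in> {2..n}" for i
  proof -
    have "i \<in> {1..n} - {1}" using i by auto
    moreover have "\<forall>i\<in>{1..n} - {1}. \<exists>p. apath i p 1 \<and> p \<noteq> [] \<and> parent i = snd (hd p)"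
      using par unfolding parent_array_def with_proj_simps by blast
    ultimately obtain p where p: "apath i p 1" "p \<noteq> []" "parent i = snd (hd p)"
      by blast
    then obtain h p' where h: "p = (i, h) # p'" "(i, h) \<in> parcs T" "apath h p' 1" "i \<notin> set (awalk_verts h p')"
      by (cases p) (auto simp: apath_Cons_iff)
    \<comment> \<open>A first step to any other neighbour would go down, which \<open>away\<close>
      excludes.\<close>
    have "h = q i"
    proof (rule ccontr)
      assume "h \<noteq> q i"
      with arcs[OF h(2)] have "i = q h" "h \<noteq> 1" by auto
      with away[OF h(3,4)] show False by simp
    qed
    with p h show ?thesis by simp
  qed
  show "parent i \<in> {1..n} \<and> depth i = Suc (depth (parent i))" if "i \<in> {2..n}" for i
    using parent[OF that] q[OF that] in_arcsD1 verts by auto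
  show "(u, v) \<in> parcs T \<longleftrightarrow> u \<in> {2..n} \<and> v = parent u \<or> v \<in> {2..n} \<and> u = parent v" for u v
    using arcs[of u v] parent q q_sym by auto
qed

section \<open>Matchings and paired dominating sets\<close>

text \<open>Existence and uniqueness of the edge at each vertex become covering and disjointness,
  which persist when a disjoint edge is added and allow counting vertices.\<close>

lemma perfect_matching_induced_iff:
  "perfect_matching (with_proj T \<restriction> S) M \<longleftrightarrow>
     M \<subseteq> {{u, v} | u v. (u, v) \<in> parcs T \<and> u \<in> S \<and> v \<in> S} \<and> \<Union>M = S \<and> disjoint M"
    (is "?L \<longleftrightarrow> M \<subseteq> ?E \<and> ?R")
proof -
  have "undirected_edges (with_proj T \<restriction> S) = ?E"
    unfolding undirected_edges_def by force
  moreover have "(\<forall>v\<in>S. \<exists>!e. e \<in> M \<and> v \<in> e) \<longleftrightarrow> ?R" if "M \<subseteq> ?E"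
  proof
    assume *: "\<forall>v\<in>S. \<exists>!e. e \<in> M \<and> v \<in> e"
    have sub: "\<Union>M \<subseteq> S" using that by auto
    have "disjoint M"
    proof (rule disjointI)
      fix e f assume "e \<in> M" "f \<in> M" "e \<noteq> f"
      with * sub show "e \<inter> f = {}" by blast
    qed
    moreover have "S \<subseteq> \<Union>M" using * by blast
    ultimately show ?R using sub by blast
  next
    assume ?R
    then show "\<forall>v\<in>S. \<exists>!e. e \<in> M \<and> v \<in> e" by (auto simp: disjoint_def)
  qed
  ultimately show ?thesis unfolding perfect_matching_def by auto
qed

lemma card_Union_pairs:
  assumes "disjoint M" "finite M" "\<And>e. e \<in> M \<Longrightarrow> card e = 2"
  shows "card (\<Union>M) = 2 * card M"
proof -
  have "card (\<Union>M) = sum card M"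
    using assms by (intro card_Union_disjoint) (auto simp: disjoint_def pairwise_def disjnt_def intro: card_ge_0_finite)
  also have "\<dots> = 2 * card M" using assms(3) by simp
  finally show ?thesis .
qed

lemma gamma_pr_setI:
  assumes "finite (verts G)" "paired_dominating_set G S"
    and "\<And>S'. paired_dominating_set G S' \<Longrightarrow> card S \<le> card S'"
  shows "gamma_pr_set G S"
proof -
  have "finite {S. paired_dominating_set G S}"
    using assms(1) by (rule finite_subset[rotated, OF finite_Pow_iff[THEN iffD2]])
      (auto simp: paired_dominating_set_def)
  then have "paired_domination_number G = card S"
    unfolding paired_domination_number_def using assms by (intro Min_eqI) auto
  with assms(2) show ?thesis unfolding gamma_pr_set_def by simp
qed

section \<open>The loop invariant\<close>

text \<open>The algorithm sees the tree only through its parent array; of the graph distance only a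
  level function compatible with the label order is kept.\<close>

locale levelled_parents =
  fixes n :: nat and parent depth :: "nat \<Rightarrow> nat"
  assumes two_le: "2 \<le> n"
    and parent_0: "parent 0 = 0"
    and parent_1: "parent 1 = 0"
    and parent_in: "i \<in> {2..n} \<Longrightarrow> parent i \<in> {1..n}"
    and depth_parent: "i \<in> {2..n} \<Longrightarrow> depth i = Suc (depth (parent i))"
    and depth_mono: "i \<in> {1..n} \<Longrightarrow> j \<in> {1..n} \<Longrightarrow> i < j \<Longrightarrow> depth i \<le> depth j"
begin

lemma parent_less:
  assumes "i \<in> {2..n}"
  shows "parent i < i"
proof (rule ccontr)
  assume "\<not> parent i < i"
  then have "i < parent i \<or> i = parent i" by auto
  then have "depth i \<le> depth (parent i)"
    using assms parent_in[OF assms] depth_mono[of i "parent i"] by auto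
  then show False using depth_parent[OF assms] by simp
qed

lemma parent_2: "parent 2 = 1"
  using parent_in[of 2] parent_less[of 2] two_le by auto

definition adj :: "nat \<Rightarrow> nat \<Rightarrow> bool" where
  "adj u v \<longleftrightarrow> u \<in> {2..n} \<and> v = parent u \<or> v \<in> {2..n} \<and> u = parent v"

lemma adj_sym: "adj u v \<longleftrightarrow> adj v u"
  unfolding adj_def by blast

lemma adj_irrefl: "adj u v \<Longrightarrow> u \<noteq> v"
  using parent_less[of u] parent_less[of v] unfolding adj_def by auto

text \<open>Ancestors up to three levels above, siblings (with \<open>x\<close> itself) and siblings
  of the parent: in the tree, the vertices within distance 3 of \<open>x\<close> that may carry a
  smaller label. Children, nephews and the like lie deeper, hence have larger labels.\<close>

definition near :: "nat \<Rightarrow> nat \<Rightarrow> bool" where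
  "near x y \<longleftrightarrow>
     y \<in> {parent x, parent (parent x), parent (parent (parent x))} \<or>
     parent y \<in> {parent x, parent (parent x)}"

lemma adj_cases:
  assumes "adj u v"
  obtains "u \<in> {2..n}" "v = parent u" "depth u = Suc (depth v)"
  | "v \<in> {2..n}" "u = parent v" "depth v = Suc (depth u)"
  using assms depth_parent[of u] depth_parent[of v] unfolding adj_def by auto

text \<open>A walk of length at most 3 to a smaller label does not go down twice, because labels are sorted by depth.\<close>

lemma near_if_short_walk:
  assumes "adj x u" "u = v \<or> adj u v" "adj v y" and xy: "y < x" "x \<in> {1..n}" "y \<in> {1..n}"
  shows "near x y"
proof -
  have dep: "depth y \<le> depth x" using depth_mono xy by auto
  show ?thesis
    using assms(1)
  proof (cases rule: adj_cases)
    case 1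
    note xu = this
    show ?thesis
      using assms(3)
    proof (cases rule: adj_cases)
      case 1
      with xu assms(2) show ?thesis unfolding near_def adj_def by auto
    next
      case 2
      show ?thesis
      proof (cases "u = v")
        case True with xu 2 show ?thesis unfolding near_def by auto
      next
        case False
        with assms(2) have "adj u v" by simp
        then show ?thesis
          by (cases rule: adj_cases) (use xu 2 dep in \<open>auto simp: near_def\<close>)
      qed
    qed
  next
    case 2
    note xu = this
    show ?thesis
      using assms(3)
    proof (cases rule: adj_cases)
      case 1
      show ?thesis
      proof (cases "u = v")
        case True with xu 1 xy show ?thesis by auto
      next
        case False
        with assms(2) have "adj u v" by simp
        then show ?thesis
          by (cases rule: adj_cases) (use xu 1 dep in \<open>auto simp: near_def\<close>)
      qed
    next
      case y: 2
      show ?thesis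
      proof (cases "u = v")
        case True with xu y dep show ?thesis by auto
      next
        case False
        with assms(2) have "adj u v" by simp
        then show ?thesis
          by (cases rule: adj_cases) (use xu y dep in \<open>auto simp: near_def\<close>)
      qed
    qed
  qed
qed

text \<open>Steps (a) and (b) can act on a vertex only if this fails there. It asks for a neighbour
  in the set even when \<open>v\<close> itself belongs to the set.\<close>

definition covered :: "pd_state \<Rightarrow> nat \<Rightarrow> bool" where
  "covered s v \<longleftrightarrow> DomByChild s v \<or> InPD s (parent v)"

definition edge_to_parent :: "nat \<Rightarrow> nat set" where
  "edge_to_parent c = {c, parent c}"

text \<open>
  \<open>X\<close> collects the witnesses, the vertices whose processing enlarged the set, and \<open>M\<close> is the
  matching built so far.  Entry 0 of \<^const>\<open>DomByChild\<close> carries no information.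
\<close>

definition loop_inv :: "nat \<Rightarrow> pd_state \<Rightarrow> nat set \<Rightarrow> nat set set \<Rightarrow> bool" where
  "loop_inv m s X M \<longleftrightarrow>
     \<Union>M = {v. InPD s v} \<and> M \<subseteq> edge_to_parent ` {2..n} \<and> disjoint M \<and> card M = card X \<and>
     X \<subseteq> {m..n} \<and>
     (\<forall>x\<in>X. \<forall>y\<in>{1..n}. near x y \<longrightarrow> covered s y) \<and>
     (\<forall>x\<in>X. \<forall>y\<in>X. y < x \<longrightarrow> \<not> near x y) \<and>
     (\<forall>v\<in>{1..n}. DomByChild s v \<longrightarrow> (\<exists>c\<in>{2..n}. parent c = v \<and> InPD s c)) \<and>
     (\<forall>v. InPD s v \<longrightarrow> covered s v) \<and>
     (\<forall>v. InPD s v \<longrightarrow> v \<noteq> 1 \<longrightarrow> covered s (parent v)) \<and>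
     (\<forall>v\<in>{m..n}. covered s v)"

text \<open>The set is a union of tree edges, so the dummy vertex 0 never enters it, and
  \<open>parent 1 = 0\<close> cannot cover the root.\<close>

lemma InPD_in_range:
  assumes "loop_inv m s X M" "InPD s v"
  shows "v \<in> {1..n}"
proof -
  note I = assms(1)[unfolded loop_inv_def]
  have "v \<in> \<Union>M" using I assms(2) by auto
  moreover have "M \<subseteq> edge_to_parent ` {2..n}" using I by auto
  ultimately obtain c where "c \<in> {2..n}" "v \<in> {c, parent c}"
    unfolding edge_to_parent_def by blast
  then show ?thesis using parent_in[of c] by auto
qed

text \<open>The update common to all three ways of enlarging the set: \<open>i\<close> is the new
  witness and \<open>{c, parent c}\<close> the new matching edge, with \<open>c\<close> equal to
  \<open>parent i\<close> in step (a), to \<open>i\<^sub>1\<close> in step (b) and to 2 in the final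
  step. \<open>E\<close> holds the entries of \<open>DomByChild\<close> set to true.\<close>

lemma loop_inv_add_pair:
  assumes inv: "loop_inv (Suc i) s X M" and i: "i \<in> {1..n}" "\<not> covered s i"
    and c: "c \<in> {2..n}" "\<not> InPD s c" "\<not> InPD s (parent c)"
    and s': "InPD s' = (InPD s)(c := True, parent c := True)"
    and dom: "\<And>v. DomByChild s' v \<longleftrightarrow> DomByChild s v \<or> v \<in> E"
    and E: "parent c \<in> E" "E \<subseteq> {parent c, parent (parent c)}"
    and grand: "parent c \<noteq> 1 \<Longrightarrow> covered s' (parent (parent c))"
    and cov: "\<And>y. y \<in> {1..n} \<Longrightarrow> near i y \<Longrightarrow> covered s' y" "covered s' i"
  shows "loop_inv i s' (insert i X) (insert (edge_to_parent c) M)"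
proof -
  note I = inv[unfolded loop_inv_def]
  have mono: "covered s v \<Longrightarrow> covered s' v" for v
    unfolding covered_def s' dom by auto
  have new: "edge_to_parent c \<inter> \<Union>M = {}"
    using I c unfolding edge_to_parent_def by auto
  have fin: "finite M" "finite X"
    using I by (meson finite_atLeastAtMost finite_imageI finite_subset)+
  have "edge_to_parent c \<notin> M"
    using new unfolding edge_to_parent_def by blast
  moreover have above: "i < z" if "z \<in> X" for z using that I by auto
  ultimately have card: "card (insert (edge_to_parent c) M) = card (insert i X)"
    using fin I by (metis card_insert_disjoint less_irrefl)
  have disj: "disjoint (insert (edge_to_parent c) M)"
    using I new by (auto simp: disjoint_def)
  have union: "\<Union> (insert (edge_to_parent c) M) = {v. InPD s' v}"
    using I unfolding s' edge_to_parent_def by auto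
  have edges: "insert (edge_to_parent c) M \<subseteq> edge_to_parent ` {2..n}"
    using I c by blast
  have far: "\<forall>x\<in>insert i X. \<forall>y\<in>insert i X. y < x \<longrightarrow> \<not> near x y"
  proof (intro ballI impI)
    fix x y assume xy: "x \<in> insert i X" "y \<in> insert i X" "y < x"
    \<comment> \<open>As \<open>i\<close> lies below all old witnesses, it can only be the smaller
      vertex of the pair.\<close>
    with above have x: "x \<in> X" by fastforce
    show "\<not> near x y"
    proof (cases "y = i")
      \<comment> \<open>Whatever is near an old witness was covered in \<open>s\<close>, whereas
        \<open>i\<close> was not.\<close>
      case True with x I i show ?thesis by blast
    next
      case False with x xy I show ?thesis by blast
    qed
  qed
  have near_covered: "\<forall>x\<in>insert i X. \<forall>y\<in>{1..n}. near x y \<longrightarrow> covered s' y"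
    using I cov mono by blast
  have child: "\<exists>d\<in>{2..n}. parent d = v \<and> InPD s' d" if v: "v \<in> {1..n}" "DomByChild s' v" for v
  proof (cases "DomByChild s v")
    case True
    with I v show ?thesis unfolding s' by (metis fun_upd_apply)
  next
    case False
    then consider "v = parent c" | "v = parent (parent c)" using v E dom by auto
    then show ?thesis
    proof cases
      case 1 then show ?thesis using c unfolding s' by auto
    next
      case 2
      \<comment> \<open>Otherwise \<open>v\<close> would be the dummy vertex 0. So
        \<open>parent c\<close> is a child of \<open>v\<close> that has just entered the
        set.\<close>
      have "parent c \<noteq> 1" using 2 v parent_1 by auto
      then have "parent c \<in> {2..n}" using parent_in[OF c(1)] by auto
      then show ?thesis using 2 unfolding s' by (intro bexI[of _ "parent c"]) auto
    qed
  qed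
  have pair: "covered s' c" "covered s' (parent c)"
    using E(1) unfolding covered_def s' dom by simp_all
  have InPD: "InPD s v \<or> v = c \<or> v = parent c" if "InPD s' v" for v
    using that unfolding s' by (auto split: if_splits)
  have self: "covered s' v" if "InPD s' v" for v
  proof -
    have "covered s v" if "InPD s v" using that I by blast
    with InPD[OF that] mono pair show ?thesis by blast
  qed
  have up: "covered s' (parent v)" if "InPD s' v" "v \<noteq> 1" for v
  proof -
    have "covered s (parent v)" if "InPD s v" using that \<open>v \<noteq> 1\<close> I by blast
    with InPD[OF that(1)] that(2) mono pair grand show ?thesis by blast
  qed
  have rest: "covered s' v" if "v \<in> {i..n}" for v
  proof (cases "v = i")
    case False
    then have "covered s v" using that I by auto
    then show ?thesis by (rule mono)
  qed (use cov in simp)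
  have subset: "insert i X \<subseteq> {i..n}" using I i by auto
  show ?thesis
    unfolding loop_inv_def
    by (intro conjI union edges disj card subset near_covered far ballI allI impI)
      (fact child self up rest)+
qed

lemma loop_inv_skip:
  assumes "loop_inv (Suc i) s X M" "covered s i"
  shows "loop_inv i s X M"
proof -
  note I = assms(1)[unfolded loop_inv_def]
  have "covered s v" if "v \<in> {i..n}" for v
    using that I assms(2) by (cases "v = i") auto
  moreover have "X \<subseteq> {i..n}" using I by auto
  ultimately show ?thesis using I unfolding loop_inv_def by blast
qed

text \<open>At an uncovered \<open>i\<close> exactly one of the two steps acts. Step (a) covers
  everything near \<open>i\<close> by its own writes. In step (b) with \<open>p \<noteq> 1\<close>
  the vertex \<open>g\<close> is already in the set, so the invariant supplies that \<open>g\<close>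
  and, for \<open>g \<noteq> 1\<close>, its parent are covered.\<close>

lemma loop_inv_step:
  assumes inv: "loop_inv (Suc i) s X M" and i: "i \<in> {2..n}"
  shows "\<exists>X M. loop_inv i (step_b n parent i (step_a parent i s)) X M"
proof (cases "covered s i")
  case True
  then have "step_b n parent i (step_a parent i s) = s"
    unfolding covered_def step_a_def step_b_def by (auto simp: Let_def)
  with loop_inv_skip[OF inv True] show ?thesis by auto
next
  case False
  note I = inv[unfolded loop_inv_def]
  define p g where "p = parent i" and "g = parent p"
  have i1: "i \<in> {1..n}" using i by auto
  have unc: "\<not> DomByChild s i" "\<not> InPD s p" using False unfolding covered_def p_def by auto
  have p: "p \<in> {1..n}" using parent_in i unfolding p_def by auto
  show ?thesis
  proof (cases "p \<noteq> 1 \<and> \<not> InPD s g")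
    case True
    define s' where "s' = step_a parent i s"
    have s': "InPD s' = (InPD s)(p := True, g := True)"
        "DomByChild s' = (DomByChild s)(g := True, parent g := True)"
      using True unc unfolding s'_def step_a_def p_def g_def by (auto simp: Let_def)
    \<comment> \<open>Step (a) has just put \<open>p\<close> into the set, which blocks step
      (b).\<close>
    have "step_b n parent i s' = s'"
      unfolding step_b_def using s' by (simp add: Let_def p_def)
    moreover have "p \<in> {2..n}" using p True by auto
    moreover have "covered s' y" if "y \<in> {1..n}" "near i y" for y
      using that unfolding near_def covered_def s' p_def[symmetric] g_def by auto
    moreover have "covered s' i" unfolding covered_def s' p_def by simp
    ultimately have "loop_inv i s' (insert i X) (insert (edge_to_parent p) M)"
      using unc True
      by (intro loop_inv_add_pair[OF inv i1 False, of p s' "{g, parent g}"])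
        (auto simp: s' covered_def g_def)
    with \<open>step_b n parent i s' = s'\<close> show ?thesis unfolding s'_def by metis
  next
    case cond: False
    have a: "step_a parent i s = s"
      using cond unc unfolding step_a_def p_def g_def by (auto simp: Let_def)
    define C where "C = {j \<in> {1..n}. parent j = p \<and> \<not> InPD (s\<lparr>InPD := (InPD s)(p := True)\<rparr>) j}"
    define c where "c = Max C"
    define s' where "s' = step_b n parent i s"
    have s': "InPD s' = (InPD s)(c := True, p := True)"
        "DomByChild s' = (DomByChild s)(p := True)"
      using cond unc unfolding s'_def step_b_def c_def C_def p_def g_def
      by (auto simp: Let_def fun_eq_iff)
    \<comment> \<open>Members of the set are covered and \<open>i\<close> is not; hence
      \<open>i\<close> is itself a candidate, and the maximum is taken over a nonempty set.\<close>
    have "\<not> InPD s i" using I False by auto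
    moreover have "i \<noteq> p" using parent_less[OF i] p_def by auto
    ultimately have "i \<in> C" unfolding C_def using i1 p_def by auto
    then have "C \<noteq> {}" by auto
    moreover have "finite C" unfolding C_def by simp
    ultimately have "c \<in> C" unfolding c_def by (rule Max_in[rotated])
    then have c: "c \<in> {1..n}" "parent c = p" "\<not> InPD s c" "c \<noteq> p"
      unfolding C_def by (auto split: if_splits)
    moreover have "c \<noteq> 1" using c p parent_1 by auto
    ultimately have c2: "c \<in> {2..n}" by auto
    have mono: "covered s v \<Longrightarrow> covered s' v" for v
      unfolding covered_def s' by auto
    have g: "covered s' g" if "p \<noteq> 1"
      using that cond I mono by auto
    have cov: "covered s' y" if y: "y \<in> {1..n}" "near i y" for y
    proof -
      consider "y = p" | "y = g" | "y = parent g" | "parent y = p" | "parent y = g"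
        using y unfolding near_def p_def g_def by auto
      then show ?thesis
      proof cases
        case 1 then show ?thesis unfolding covered_def s' by simp
      next
        case 2
        then have "p \<noteq> 1" using parent_1 y g_def by auto
        with g 2 show ?thesis by simp
      next
        case 3
        then have "g \<noteq> 0" "g \<noteq> 1" using y parent_0 parent_1 by (metis atLeastAtMost_iff not_one_le_zero)+
        then have "InPD s g" using cond g_def parent_1 by auto
        then show ?thesis using 3 I \<open>g \<noteq> 1\<close> mono by auto
      next
        case 4 then show ?thesis unfolding covered_def s' by simp
      next
        case 5
        \<comment> \<open>For \<open>p = 1\<close> the vertex \<open>g\<close> is the dummy 0, whose
          only child in the range is the root, that is \<open>p\<close> itself. Otherwise
          \<open>g\<close> is in the set and covers its children.\<close>
        show ?thesis
        proof (cases "p = 1")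
          case True
          then have "parent y = 0" using 5 parent_1 g_def by simp
          moreover have "parent y \<ge> 1" if "y \<noteq> 1" using parent_in[of y] y that by auto
          ultimately have "y = 1" by fastforce
          with True show ?thesis unfolding covered_def s' by simp
        next
          case False
          then show ?thesis using cond 5 unfolding covered_def s' by auto
        qed
      qed
    qed
    have "covered s' i" unfolding covered_def s' p_def by simp
    then have "loop_inv i s' (insert i X) (insert (edge_to_parent c) M)"
      using c c2 unc cov g
      by (intro loop_inv_add_pair[OF inv i1 False, of c s' "{p}"]) (auto simp: s' g_def)
    with a show ?thesis unfolding s'_def by metis
  qed
qed

section \<open>The invariant along the whole run\<close>

lemma loop_inv_init: "loop_inv (Suc n) init_state {} {}"
  unfolding loop_inv_def init_state_def by (auto simp: disjoint_def)

lemma loop_inv_main_loop: "\<exists>X M. loop_inv 2 (main_loop n parent) X M"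
proof -
  define f where "f = (\<lambda>i s. step_b n parent i (step_a parent i s))"
  \<comment> \<open>After \<open>k\<close> passes the labels from \<open>Suc n - k\<close> to
    \<open>n\<close> are done; \<open>k = n - 1\<close> leaves just the root.\<close>
  have "\<exists>X M. loop_inv (Suc n - k) (fold f (rev [Suc n - k..<Suc n]) init_state) X M"
    if "k \<le> n - 1" for k
    using that
  proof (induction k)
    case 0
    then show ?case using loop_inv_init by auto
  next
    case (Suc k)
    define m where "m = n - k"
    have m: "Suc n - Suc k = m" "Suc n - k = Suc m" "m \<in> {2..n}"
      using Suc.prems two_le by (auto simp: m_def)
    have "rev [m..<Suc n] = rev [Suc m..<Suc n] @ [m]"
      using m by (subst upt_conv_Cons) auto
    with Suc m loop_inv_step[of m] show ?case
      unfolding m by (fastforce simp: f_def)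
  qed
  from this[of "n - 1"] show ?thesis
    unfolding main_loop_def f_def[symmetric] using two_le
    by (simp add: Suc_diff_le numeral_2_eq_2 Suc_diff_Suc)
qed

text \<open>An uncovered root becomes one more witness, with the edge \<open>{2, 1}\<close>; in the
  tree nothing but the root itself is near 1.\<close>

lemma loop_inv_final: "\<exists>X M. loop_inv 1 (final_step (main_loop n parent)) X M"
proof -
  obtain X M where inv: "loop_inv (Suc 1) (main_loop n parent) X M"
    using loop_inv_main_loop by (auto simp: numeral_2_eq_2)
  define s where "s = main_loop n parent"
  note inv = inv[folded s_def]
  note I = inv[unfolded loop_inv_def]
  have 0: "\<not> InPD s 0" using InPD_in_range[OF inv] by force
  show ?thesis
  proof (cases "DomByChild s 1")
    case True
    then show ?thesis
      using loop_inv_skip[OF inv] unfolding final_step_def s_def covered_def by auto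
  next
    case False
    then have unc: "\<not> covered s 1" unfolding covered_def using 0 parent_1 by simp
    \<comment> \<open>By the invariant, members of the set and their parents are covered, so an
      uncovered root keeps both itself and its child 2 outside the set.\<close>
    have one: "\<not> InPD s 1" using I unc by blast
    have two: "\<not> InPD s 2" using I unc parent_2 by force
    define s' where "s' = final_step s"
    have s': "InPD s' = (InPD s)(2 := True, 1 := True)"
        "DomByChild s' = (DomByChild s)(1 := True)"
      using False unfolding s'_def final_step_def by (auto simp: fun_eq_iff)
    have "y = 1" if "y \<in> {1..n}" "near 1 y" for y
      using that parent_in[of y] unfolding near_def parent_1 parent_0 by (cases "y = 1") auto
    then have "covered s' y" if "y \<in> {1..n}" "near 1 y" for y
      using that unfolding covered_def s' by auto
    moreover have "covered s' 1" unfolding covered_def s' by simp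
    ultimately have "loop_inv 1 s' (insert 1 X) (insert (edge_to_parent 2) M)"
      using loop_inv_add_pair[OF inv _ unc, of 2 s' "{1}"] two_le one two parent_2 s' by auto
    then show ?thesis unfolding s'_def s_def by auto
  qed
qed

section \<open>Optimality\<close>

text \<open>
  Every vertex has a neighbour in a paired dominating set, hence a neighbour on some edge of its
  matching; one edge cannot serve two vertices that are far apart.
\<close>

lemma paired_dominating_set_card_ge:
  assumes arcs: "\<And>u v. (u, v) \<in> parcs T \<longleftrightarrow> adj u v" and verts: "pverts T = {1..n}"
    and pd: "paired_dominating_set (with_proj T) S"
    and X: "X \<subseteq> {1..n}" "\<And>x y. x \<in> X \<Longrightarrow> y \<in> X \<Longrightarrow> y < x \<Longrightarrow> \<not> near x y"
  shows "2 * card X \<le> card S"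
proof -
  from pd obtain M where "perfect_matching (with_proj T \<restriction> S) M"
    unfolding paired_dominating_set_def by blast
  then have M: "M \<subseteq> {{u, v} | u v. adj u v \<and> u \<in> S \<and> v \<in> S}" "\<Union>M = S" "disjoint M"
    unfolding perfect_matching_induced_iff arcs by auto
  have "S \<subseteq> {1..n}" using pd verts unfolding paired_dominating_set_def by auto
  then have "finite S" using finite_subset by blast
  then have "finite M" using M(2) finite_UnionD by blast
  have pairs: "card e = 2" if "e \<in> M" for e
    using that M(1) adj_irrefl by (auto simp: card_insert_if)
  \<comment> \<open>A member of \<open>S\<close> has its matching partner, any other vertex a
    dominating neighbour, which lies on some matching edge.\<close>
  have "\<exists>e\<in>M. \<exists>u\<in>e. adj x u" if "x \<in> X" for x
  proof (cases "x \<in> S")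
    case True
    then obtain e where e: "e \<in> M" "x \<in> e" using M by blast
    then obtain u v where "e = {u, v}" "adj u v" using M by blast
    with e adj_sym show ?thesis by blast
  next
    case False
    then have "x \<in> verts (with_proj T) - S" using that X verts by auto
    then obtain u where "u \<in> S" "x \<rightarrow>\<^bsub>with_proj T\<^esub> u"
      using pd unfolding paired_dominating_set_def by blast
    then have "adj x u" using arcs by (auto simp: arcs_ends_def arc_to_ends_def)
    with \<open>u \<in> S\<close> M show ?thesis by blast
  qed
  then obtain e where e: "\<And>x. x \<in> X \<Longrightarrow> e x \<in> M \<and> (\<exists>u\<in>e x. adj x u)" by metis
  have far: "e x \<noteq> e y" if xy: "x \<in> X" "y \<in> X" "y < x" for x y
  proof
    assume eq: "e x = e y"
    \<comment> \<open>The walk from \<open>x\<close> to \<open>u\<close>, along the shared edge if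
      \<open>u \<noteq> v\<close>, and on to \<open>y\<close> has length at most 3.\<close>
    obtain u v where u: "u \<in> e x" "adj x u" and v: "v \<in> e x" "adj v y"
      using e[OF xy(1)] e[OF xy(2)] eq adj_sym by metis
    obtain a b where "e x = {a, b}" "adj a b" using e[OF xy(1)] M by blast
    then have "u = v \<or> adj u v" using u(1) v(1) adj_sym by auto
    then have "near x y"
      by (rule near_if_short_walk[OF u(2) _ v(2) xy(3)]) (use xy X(1) in auto)
    with X(2)[OF xy] show False by simp
  qed
  have "inj_on e X"
    by (rule inj_onI) (metis far linorder_neqE_nat)
  moreover have "e ` X \<subseteq> M" using e by auto
  ultimately have "card X \<le> card M" using \<open>finite M\<close> by (metis card_inj_on_le)
  with card_Union_pairs[OF M(3) \<open>finite M\<close> pairs] M(2) show ?thesis by simp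
qed

text \<open>At the end every vertex is covered, so \<open>S\<close> dominates, and the matching of
  the invariant is perfect on it. It has as many edges as there are witnesses, so
  \<open>card S = 2 * card X\<close>, which is the lower bound for every paired dominating
  set.\<close>

lemma gamma_pr_set_tree_paired_domination:
  assumes arcs: "\<And>u v. (u, v) \<in> parcs T \<longleftrightarrow> adj u v" and verts: "pverts T = {1..n}"
  shows "gamma_pr_set (with_proj T) {i \<in> {1..n}. tree_paired_domination n parent i}"
proof -
  define s where "s = final_step (main_loop n parent)"
  obtain X M where inv: "loop_inv 1 s X M" using loop_inv_final s_def by auto
  note I = inv[unfolded loop_inv_def]
  define S where "S = {v. InPD s v}"
  have range: "v \<in> {1..n}" if "v \<in> S" for v
    using InPD_in_range[OF inv] that by (simp add: S_def)
  have "S = {i \<in> {1..n}. tree_paired_domination n parent i}"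
    using range unfolding S_def tree_paired_domination_def s_def by blast
  moreover have "gamma_pr_set (with_proj T) S"
  proof (rule gamma_pr_setI)
    show "finite (verts (with_proj T))" using verts by simp
    have union: "\<Union>M = S" and disj: "disjoint M" and edges: "M \<subseteq> edge_to_parent ` {2..n}"
      using I by (simp_all add: S_def)
    have adj_parent: "adj c (parent c)" if "c \<in> {2..n}" for c
      using that unfolding adj_def by simp
    have "perfect_matching (with_proj T \<restriction> S) M"
      unfolding perfect_matching_induced_iff arcs
    proof (intro conjI subsetI union disj)
      fix e assume e: "e \<in> M"
      with edges obtain c where c: "c \<in> {2..n}" "e = {c, parent c}"
        unfolding edge_to_parent_def by blast
      moreover have "c \<in> S" "parent c \<in> S" using e c union by auto
      ultimately show "e \<in> {{u, v} | u v. adj u v \<and> u \<in> S \<and> v \<in> S}"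
        using adj_parent by blast
    qed
    moreover have "\<exists>u\<in>S. v \<rightarrow>\<^bsub>with_proj T\<^esub> u" if v: "v \<in> {1..n}" for v
    proof -
      have "covered s v" using I v by blast
      then have "\<exists>u\<in>S. adj v u"
        unfolding covered_def
      proof
        assume "DomByChild s v"
        then obtain c where "c \<in> {2..n}" "parent c = v" "InPD s c" using I v by blast
        then show ?thesis using adj_parent adj_sym unfolding S_def by blast
      next
        assume "InPD s (parent v)"
        then have "parent v \<in> S" unfolding S_def by simp
        \<comment> \<open>The parent entry of the root is 0, which is not in
          \<open>S\<close>.\<close>
        then have "v \<noteq> 1" using range parent_1 by fastforce
        then have "v \<in> {2..n}" using v by auto
        with \<open>parent v \<in> S\<close> adj_parent show ?thesis by blast
      qed
      then obtain u where "u \<in> S" "(v, u) \<in> parcs T" using arcs by blast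
      then show ?thesis by (force simp: arcs_ends_def arc_to_ends_def)
    qed
    ultimately show "paired_dominating_set (with_proj T) S"
      unfolding paired_dominating_set_def using range verts by auto
    have "finite M" using edges finite_surj by blast
    moreover have "card e = 2" if e: "e \<in> M" for e
    proof -
      obtain c where "c \<in> {2..n}" "e = {c, parent c}"
        using e edges unfolding edge_to_parent_def by blast
      then show ?thesis using parent_less[of c] by (simp add: card_insert_if)
    qed
    ultimately have "card S = 2 * card X"
      using card_Union_pairs[OF disj] union I by metis
    moreover have "2 * card X \<le> card S'" if "paired_dominating_set (with_proj T) S'" for S'
      using I by (intro paired_dominating_set_card_ge[OF arcs verts that]) auto
    ultimately show "card S \<le> card S'" if "paired_dominating_set (with_proj T) S'" for S'
      using that by simp
  qed
  ultimately show ?thesis by simp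
qed

end

section \<open>From trees to levelled parent functions\<close>

theorem theorem1:
  fixes T :: "nat pair_pre_digraph" and n :: nat and parent :: "nat \<Rightarrow> nat" and S :: "nat set"
  assumes "n \<ge> 2"
    and "undirected_tree T"
    and "pverts T = {1..n}"
    and "\<forall>i\<in>{1..n}. \<forall>j\<in>{1..n}. i < j \<longrightarrow>
           graph_dist (with_proj T) 1 i \<le> graph_dist (with_proj T) 1 j"
    and "parent_array T n parent"
    and "S = {i \<in> {1..n}. tree_paired_domination n parent i}"
  shows "gamma_pr_set (with_proj T) S"
proof -
  \<comment> \<open>The distance from the root as a natural number; \<open>T(3)\<close> carries the
    assumption on labels over to it.\<close>
  define depth where
    "depth i = (LEAST k. \<exists>p. pre_digraph.awalk (with_proj T) 1 p i \<and> length p = k)" for i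
  have "1 \<le> n" using assms(1) by simp
  note T = parent_structure[OF assms(2,3,5) depth_def this]
  interpret levelled_parents n parent depth
  proof
    show "parent 0 = 0" "parent 1 = 0" using assms(5) unfolding parent_array_def by simp_all
    show "depth i \<le> depth j" if "i \<in> {1..n}" "j \<in> {1..n}" "i < j" for i j
    proof -
      have "ereal (depth i) \<le> ereal (depth j)"
        using assms(4) that T(3) by metis
      then show ?thesis by simp
    qed
  qed (use assms(1) T(1) in auto)
  have "(u, v) \<in> parcs T \<longleftrightarrow> adj u v" for u v
    unfolding adj_def by (rule T(2))
  from gamma_pr_set_tree_paired_domination[OF this assms(3)] show ?thesis
    unfolding assms(6) .
qed

end
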